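(* Let $\Omega\subseteq\mathbb{R}^N$ be a bounded domain with $C^2$-boundary, $1<q<p<\infty$, let $a_1,a_2$ satisfy $H_0$ and let $f$ satisfy $H_1''$. Let $\lambda>0$ with $\lambda<\widehat\lambda_1(q,a_2)$. Then the Dirichlet problem $$-\Delta_p^{a_1}u(z)-\Delta_q^{a_2}u(z)=\lambda|u(z)|^{q-2}u(z)+f(z,u(z))\ \text{ in }\Omega,\qquad u|_{\partial\Omega}=0$$ does not admit a nontrivial solution.
   Context: For $r\in(1,\infty)$ and a weight $a$, $\Delta_r^a u=\operatorname{div}(a(z)|\nabla u|^{r-2}\nabla u)$. A solution is a weak solution: $u\in W_0^{1,p}(\Omega)$ with $$\int_\Omega a_1|\nabla u|^{p-2}(\nabla u,\nabla h)\,dz+\int_\Omega a_2|\nabla u|^{q-2}(\nabla u,\nabla h)\,dz=\int_\Omega[\lambda|u|^{q-2}u+f(z,u)]h\,dz\quad\text{for all }h\in W_0^{1,p}(\Omega);$$ nontrivial means $u\ne0$. $\widehat\lambda_1(r,a)>0$ is the smallest eigenvalue of $(-\Delta_r^a,W_0^{1,r}(\Omega))$, i.e. $\widehat\lambda_1(r,a)=\inf\{\int_\Omega a|\nabla u|^r dz/\|u\|_r^r:u\in W_0^{1,r}(\Omega),u\ne0\}$. $H_0$: $a_1,a_2\in C^{0,1}(\overline\Omega)$ (Lipschitz continuous) and there is $c_1>0$ with $c_1\le a_1(z),a_2(z)$ for all $z\in\overline\Omega$. $H_1''$: $f:\Omega\times\mathbb{R}\to\mathbb{R}$ is a Carathéodory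 function (measurable in $z$, continuous in $x$), $f(z,0)=0$ for a.a. $z\in\Omega$, and, with $F(z,x)=\int_0^x f(z,s)\,ds$: (i) for every $\rho>0$ there is $a_\rho\in L^\infty(\Omega)$ with $|f(z,x)|\le a_\rho(z)$ for a.a. $z\in\Omega$, all $|x|\le\rho$; (ii) $\limsup_{x\to\pm\infty}\frac{f(z,x)}{|x|^{p-2}x}\le\widehat\lambda_1(p,a_1)$ uniformly for a.a. $z\in\Omega$; (iii) there is $\tau\in(q,p)$ with $\lim_{x\to\pm\infty}\frac{f(z,x)x-pF(z,x)}{|x|^\tau}=+\infty$ uniformly for a.a. $z\in\Omega$; (iv) $\lim_{x\to0}\frac{f(z,x)}{|x|^{q-2}x}=0$ uniformly for a.a. $z\in\Omega$; (v) for every $s>0$ there is $m_s>0$ with $m_s\le f(z,x)x$ for a.a. $z\in\Omega$, all $|x|\ge s$; (vi) $f(z,x)x\le\widehat\lambda_1(p,a_1)|x|^p$ for a.a. $z\in\Omega$, all $x\in\mathbb{R}$. *)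

theory Defs
  imports "HOL-Analysis.Analysis"
begin

subsection \<open>Smooth functions and domains\<close>

definition partial_deriv :: "'a::euclidean_space \<Rightarrow> ('a \<Rightarrow> real) \<Rightarrow> 'a \<Rightarrow> real" where
  "partial_deriv b \<phi> z = frechet_derivative \<phi> (at z) b"

definition gradient :: "('a::euclidean_space \<Rightarrow> real) \<Rightarrow> 'a \<Rightarrow> 'a" where
  "gradient \<phi> z = (\<Sum>b\<in>Basis. partial_deriv b \<phi> z *\<^sub>R b)"

primrec Ck :: "nat \<Rightarrow> ('a::euclidean_space \<Rightarrow> real) \<Rightarrow> bool" where
  "Ck 0 \<phi> \<longleftrightarrow> continuous_on UNIV \<phi>"
| "Ck (Suc k) \<phi> \<longleftrightarrow> (\<forall>z. \<phi> differentiable (at z)) \<and> (\<forall>b\<in>Basis. Ck k (partial_deriv b \<phi>))"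

text \<open>\<open>C\<^sub>c\<^sup>\<infinity>(\<Omega>)\<close>, each function being extended by zero to the whole space.\<close>

definition test_functions :: "'a::euclidean_space set \<Rightarrow> ('a \<Rightarrow> real) set" where
  "test_functions \<Omega> = {\<phi>. (\<forall>k. Ck k \<phi>) \<and> compact (closure {z. \<phi> z \<noteq> 0}) \<and> closure {z. \<phi> z \<noteq> 0} \<subseteq> \<Omega>}"

text \<open>
  Near each boundary point, \<open>\<Omega>\<close> is the part of a ball lying above the graph of a \<open>C\<^sup>2\<close>
  function, after a rotation of the axes taking the last axis to the unit vector \<open>e\<close>. A
  function of the remaining \<open>N - 1\<close> coordinates is the restriction of some \<open>\<gamma>\<close> to the
  hyperplane orthogonal to \<open>e\<close>, and only those values of \<open>\<gamma>\<close> are used.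
\<close>

definition C2_boundary :: "'a::euclidean_space set \<Rightarrow> bool" where
  "C2_boundary \<Omega> \<longleftrightarrow>
     (\<forall>x0\<in>frontier \<Omega>. \<exists>r>0. \<exists>e \<gamma>. norm e = 1 \<and> Ck 2 \<gamma> \<and>
        \<Omega> \<inter> ball x0 r = {x \<in> ball x0 r. x \<bullet> e > \<gamma> (x - (x \<bullet> e) *\<^sub>R e)})"

definition bounded_C2_domain :: "'a::euclidean_space set \<Rightarrow> bool" where
  "bounded_C2_domain \<Omega> \<longleftrightarrow>
     open \<Omega> \<and> connected \<Omega> \<and> \<Omega> \<noteq> {} \<and> bounded \<Omega> \<and> C2_boundary \<Omega>"

subsection \<open>Lebesgue and Sobolev spaces\<close>

text \<open>
  Elements of these spaces are represented by functions rather than by classes of functions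
  agreeing almost everywhere; the values off \<open>\<Omega>\<close> are irrelevant.
\<close>

definition Lp :: "'a::euclidean_space set \<Rightarrow> real \<Rightarrow> ('a \<Rightarrow> 'b::euclidean_space) set" where
  "Lp \<Omega> r = {u. u \<in> borel_measurable (lebesgue_on \<Omega>) \<and>
                integrable (lebesgue_on \<Omega>) (\<lambda>z. norm (u z) powr r)}"

definition Lp_norm :: "'a::euclidean_space set \<Rightarrow> real \<Rightarrow> ('a \<Rightarrow> 'b::euclidean_space) \<Rightarrow> real" where
  "Lp_norm \<Omega> r u = (LINT z|lebesgue_on \<Omega>. norm (u z) powr r) powr (1 / r)"

definition Linfty :: "'a::euclidean_space set \<Rightarrow> ('a \<Rightarrow> real) set" where
  "Linfty \<Omega> = {u. u \<in> borel_measurable (lebesgue_on \<Omega>) \<and>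
                 (\<exists>C. AE z in lebesgue_on \<Omega>. \<bar>u z\<bar> \<le> C)}"

definition locally_integrable ::
    "'a::euclidean_space set \<Rightarrow> ('a \<Rightarrow> 'b::euclidean_space) \<Rightarrow> bool" where
  "locally_integrable \<Omega> u \<longleftrightarrow> (\<forall>K. compact K \<and> K \<subseteq> \<Omega> \<longrightarrow> integrable (lebesgue_on K) u)"

definition is_weak_gradient ::
    "'a::euclidean_space set \<Rightarrow> ('a \<Rightarrow> real) \<Rightarrow> ('a \<Rightarrow> 'a) \<Rightarrow> bool" where
  "is_weak_gradient \<Omega> u g \<longleftrightarrow>
     locally_integrable \<Omega> u \<and> locally_integrable \<Omega> g \<and>
     (\<forall>\<phi>\<in>test_functions \<Omega>. \<forall>b\<in>Basis.
        (LINT z|lebesgue_on \<Omega>. u z * partial_deriv b \<phi> z) =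
        - (LINT z|lebesgue_on \<Omega>. (g z \<bullet> b) * \<phi> z))"

text \<open>The choice is immaterial: on an open set, weak gradients are unique almost everywhere.\<close>

definition weak_gradient :: "'a::euclidean_space set \<Rightarrow> ('a \<Rightarrow> real) \<Rightarrow> 'a \<Rightarrow> 'a" where
  "weak_gradient \<Omega> u = (SOME g. is_weak_gradient \<Omega> u g)"

definition W1p :: "'a::euclidean_space set \<Rightarrow> real \<Rightarrow> ('a \<Rightarrow> real) set" where
  "W1p \<Omega> r = {u \<in> Lp \<Omega> r. (\<exists>g. is_weak_gradient \<Omega> u g) \<and> weak_gradient \<Omega> u \<in> Lp \<Omega> r}"

text \<open>The closure of \<open>C\<^sub>c\<^sup>\<infinity>(\<Omega>)\<close> in \<open>W\<^sup>1\<^sup>,\<^sup>r(\<Omega>)\<close>.\<close>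

definition W1p_0 :: "'a::euclidean_space set \<Rightarrow> real \<Rightarrow> ('a \<Rightarrow> real) set" where
  "W1p_0 \<Omega> r = {u \<in> W1p \<Omega> r. \<exists>\<phi>. (\<forall>n::nat. \<phi> n \<in> test_functions \<Omega>) \<and>
      (\<lambda>n. Lp_norm \<Omega> r (\<lambda>z. \<phi> n z - u z)) \<longlonglongrightarrow> 0 \<and>
      (\<lambda>n. Lp_norm \<Omega> r (\<lambda>z. gradient (\<phi> n) z - weak_gradient \<Omega> u z)) \<longlonglongrightarrow> 0}"

definition nonzero_on :: "'a::euclidean_space set \<Rightarrow> ('a \<Rightarrow> real) \<Rightarrow> bool" where
  "nonzero_on \<Omega> u \<longleftrightarrow> \<not> (AE z in lebesgue_on \<Omega>. u z = 0)"

subsection \<open>The eigenvalue, the hypotheses and the Dirichlet problem\<close>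

definition lambda1 :: "'a::euclidean_space set \<Rightarrow> real \<Rightarrow> ('a \<Rightarrow> real) \<Rightarrow> real" where
  "lambda1 \<Omega> r a =
     (INF u \<in> {u \<in> W1p_0 \<Omega> r. nonzero_on \<Omega> u}.
        (LINT z|lebesgue_on \<Omega>. a z * norm (weak_gradient \<Omega> u z) powr r) / Lp_norm \<Omega> r u powr r)"

definition H0 :: "'a::euclidean_space set \<Rightarrow> ('a \<Rightarrow> real) \<Rightarrow> ('a \<Rightarrow> real) \<Rightarrow> bool" where
  "H0 \<Omega> a1 a2 \<longleftrightarrow>
     (\<exists>L. L-lipschitz_on (closure \<Omega>) a1) \<and> (\<exists>L. L-lipschitz_on (closure \<Omega>) a2) \<and>
     (\<exists>c1>0. \<forall>z\<in>closure \<Omega>. c1 \<le> a1 z \<and> c1 \<le> a2 z)"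

definition caratheodory :: "'a::euclidean_space set \<Rightarrow> ('a \<Rightarrow> real \<Rightarrow> real) \<Rightarrow> bool" where
  "caratheodory \<Omega> f \<longleftrightarrow>
     (\<forall>x. (\<lambda>z. f z x) \<in> borel_measurable (lebesgue_on \<Omega>)) \<and>
     (AE z in lebesgue_on \<Omega>. continuous_on UNIV (f z))"

definition primitive :: "('a \<Rightarrow> real \<Rightarrow> real) \<Rightarrow> 'a \<Rightarrow> real \<Rightarrow> real" where
  "primitive f z x = (LBINT s=ereal 0..ereal x. f z s)"

text \<open>
  In (ii)--(iv) the limits are uniform for almost all \<open>z\<close>: the threshold is chosen before
  \<open>z\<close>.
\<close>

definition H1'' ::
    "'a::euclidean_space set \<Rightarrow> real \<Rightarrow> real \<Rightarrow> ('a \<Rightarrow> real) \<Rightarrow> ('a \<Rightarrow> real \<Rightarrow> real) \<Rightarrow> bool" where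
  "H1'' \<Omega> p q a1 f \<longleftrightarrow>
     caratheodory \<Omega> f \<and>
     (AE z in lebesgue_on \<Omega>. f z 0 = 0) \<and>
     \<comment> \<open>(i)\<close>
     (\<forall>\<rho>>0. \<exists>a\<in>Linfty \<Omega>. AE z in lebesgue_on \<Omega>. \<forall>x. \<bar>x\<bar> \<le> \<rho> \<longrightarrow> \<bar>f z x\<bar> \<le> a z) \<and>
     \<comment> \<open>(ii)\<close>
     (\<forall>\<epsilon>>0. \<exists>M>0. AE z in lebesgue_on \<Omega>. \<forall>x. \<bar>x\<bar> \<ge> M \<longrightarrow>
        f z x / (\<bar>x\<bar> powr (p - 2) * x) \<le> lambda1 \<Omega> p a1 + \<epsilon>) \<and>
     \<comment> \<open>(iii)\<close>
     (\<exists>\<tau>\<in>{q<..<p}. \<forall>K. \<exists>M>0. AE z in lebesgue_on \<Omega>. \<forall>x. \<bar>x\<bar> \<ge> M \<longrightarrow>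
        (f z x * x - p * primitive f z x) / \<bar>x\<bar> powr \<tau> \<ge> K) \<and>
     \<comment> \<open>(iv)\<close>
     (\<forall>\<epsilon>>0. \<exists>\<delta>>0. AE z in lebesgue_on \<Omega>. \<forall>x. 0 < \<bar>x\<bar> \<and> \<bar>x\<bar> < \<delta> \<longrightarrow>
        \<bar>f z x / (\<bar>x\<bar> powr (q - 2) * x)\<bar> < \<epsilon>) \<and>
     \<comment> \<open>(v)\<close>
     (\<forall>s>0. \<exists>m>0. AE z in lebesgue_on \<Omega>. \<forall>x. \<bar>x\<bar> \<ge> s \<longrightarrow> m \<le> f z x * x) \<and>
     \<comment> \<open>(vi)\<close>
     (AE z in lebesgue_on \<Omega>. \<forall>x. f z x * x \<le> lambda1 \<Omega> p a1 * \<bar>x\<bar> powr p)"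

text \<open>
  Since \<open>0 powr r = 0\<close>, the expressions \<open>norm v powr (r - 2) *\<^sub>R v\<close> and
  \<open>\<bar>x\<bar> powr (r - 2) * x\<close> vanish at the origin for every \<open>r > 1\<close>, as they should when \<open>r < 2\<close>.
\<close>

definition weak_solution ::
    "'a::euclidean_space set \<Rightarrow> real \<Rightarrow> real \<Rightarrow> ('a \<Rightarrow> real) \<Rightarrow> ('a \<Rightarrow> real) \<Rightarrow>
     ('a \<Rightarrow> real \<Rightarrow> real) \<Rightarrow> real \<Rightarrow> ('a \<Rightarrow> real) \<Rightarrow> bool" where
  "weak_solution \<Omega> p q a1 a2 f \<mu> u \<longleftrightarrow>
     u \<in> W1p_0 \<Omega> p \<and>
     (\<forall>h\<in>W1p_0 \<Omega> p.
        (LINT z|lebesgue_on \<Omega>. a1 z * norm (weak_gradient \<Omega> u z) powr (p - 2) *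
           (weak_gradient \<Omega> u z \<bullet> weak_gradient \<Omega> h z)) +
        (LINT z|lebesgue_on \<Omega>. a2 z * norm (weak_gradient \<Omega> u z) powr (q - 2) *
           (weak_gradient \<Omega> u z \<bullet> weak_gradient \<Omega> h z)) =
        (LINT z|lebesgue_on \<Omega>. (\<mu> * \<bar>u z\<bar> powr (q - 2) * u z + f z (u z)) * h z))"

end

theory Submission
  imports Defs
begin

text \<open>
  The proof tests the equation with the solution \<open>u\<close> itself. Writing \<open>|\<cdot>|\<^sub>r\<close> for the \<open>L\<^sup>r\<close> norm, this gives
  \<open>\<integral>a\<^sub>1|\<nabla>u|\<^sup>p + \<integral>a\<^sub>2|\<nabla>u|\<^sup>q = \<mu>|u|\<^sub>q\<^sup>q + \<integral>f(z,u)u\<close>. Hypothesis (vi) bounds the last integral by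
  \<open>\<lambda>\<^sub>1(p,a\<^sub>1)|u|\<^sub>p\<^sup>p\<close>, and the variational definition of the eigenvalue
  (\<open>lambda1_Lp_norm_le\<close>) bounds that in turn by \<open>\<integral>a\<^sub>1|\<nabla>u|\<^sup>p\<close>. What is left is
  \<open>\<integral>a\<^sub>2|\<nabla>u|\<^sup>q \<le> \<mu>|u|\<^sub>q\<^sup>q\<close>. If \<open>u\<close> is nontrivial, this makes the Rayleigh quotient of \<open>u\<close>
  for the exponent \<open>q\<close> at most \<open>\<mu> < \<lambda>\<^sub>1(q,a\<^sub>2)\<close>, which is impossible because \<open>u\<close> is an
  admissible competitor for \<open>\<lambda>\<^sub>1(q,a\<^sub>2)\<close>.

  Admissibility is the inclusion \<open>W\<^sub>0\<^sup>1\<^sup>,\<^sup>p(\<Omega>) \<subseteq> W\<^sub>0\<^sup>1\<^sup>,\<^sup>q(\<Omega>)\<close> (\<open>W1p_0_subset\<close>), which holds because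
  on a set of finite measure the \<open>L\<^sup>p\<close> norm dominates the \<open>L\<^sup>q\<close> norm (\<open>Lp_norm_le_Lp_norm\<close>), so
  that approximation by test functions in the stronger norm implies approximation in the
  weaker one.
\<close>

section \<open>Lebesgue spaces on sets of finite measure\<close>

text \<open>
  Either \<open>x \<le> t\<close> and the first summand suffices, or \<open>x > t\<close> and
  \<open>x\<^sup>q = x\<^sup>p x\<^bsup>q - p\<^esup> \<le> x\<^sup>p t\<^bsup>q - p\<^esup>\<close>. This splitting, with \<open>t\<close> chosen suitably,
  takes the place of Hoelder's inequality below.
\<close>

lemma powr_le_split:
  fixes x t p q :: real
  assumes "0 \<le> x" "0 < t" "0 \<le> q" "q \<le> p"
  shows "x powr q \<le> t powr q + t powr (q - p) * x powr p"
proof (cases "x \<le> t")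
  case True
  then have "x powr q \<le> t powr q"
    using assms by (intro powr_mono2) auto
  then show ?thesis
    by (simp add: add_increasing2)
next
  case False
  have "x powr q = x powr (q - p) * x powr p"
    by (simp flip: powr_add)
  also have "\<dots> \<le> t powr (q - p) * x powr p"
    using assms False by (intro mult_right_mono powr_mono2') auto
  finally show ?thesis
    by (simp add: add_increasing)
qed

lemma Lp_mono_exponent:
  fixes \<Omega> :: "'a::euclidean_space set" and v :: "'a \<Rightarrow> 'b::euclidean_space"
  assumes "\<Omega> \<in> lmeasurable" "0 \<le> q" "q \<le> p" "v \<in> Lp \<Omega> p"
  shows "v \<in> Lp \<Omega> q"
proof -
  interpret finite_measure "lebesgue_on \<Omega>"
    using assms(1) by (rule finite_measure_lebesgue_on)
  have [measurable]: "v \<in> borel_measurable (lebesgue_on \<Omega>)"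
    and int: "integrable (lebesgue_on \<Omega>) (\<lambda>z. norm (v z) powr p)"
    using assms(4) by (auto simp: Lp_def)
  have "integrable (lebesgue_on \<Omega>) (\<lambda>z. norm (v z) powr q)"
  proof (rule Bochner_Integration.integrable_bound)
    show "integrable (lebesgue_on \<Omega>) (\<lambda>z. 1 + norm (v z) powr p)"
      using int by simp
    show "AE z in lebesgue_on \<Omega>. norm (norm (v z) powr q) \<le> norm (1 + norm (v z) powr p)"
      using powr_le_split[of "norm (v _)" 1 q p] assms(2,3) by simp
  qed measurable
  then show ?thesis
    by (simp add: Lp_def)
qed

lemma Lp_norm_powr:
  assumes "0 < r"
  shows "Lp_norm \<Omega> r u powr r = (LINT z|lebesgue_on \<Omega>. norm (u z) powr r)"
proof -
  have "0 \<le> (LINT z|lebesgue_on \<Omega>. norm (u z) powr r)"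
    by (intro integral_nonneg_AE) simp
  then show ?thesis
    using assms by (simp add: Lp_norm_def powr_powr)
qed

lemma Lp_norm_eq_0_iff:
  assumes "0 < r" "u \<in> Lp \<Omega> r"
  shows "Lp_norm \<Omega> r u = 0 \<longleftrightarrow> (AE z in lebesgue_on \<Omega>. u z = 0)"
proof -
  have "Lp_norm \<Omega> r u = 0 \<longleftrightarrow> (LINT z|lebesgue_on \<Omega>. norm (u z) powr r) = 0"
    by (simp add: Lp_norm_def)
  also have "\<dots> \<longleftrightarrow> (AE z in lebesgue_on \<Omega>. norm (u z) powr r = 0)"
    using assms by (intro integral_nonneg_eq_0_iff_AE) (auto simp: Lp_def)
  finally show ?thesis
    by simp
qed

text \<open>
  Integrating \<open>powr_le_split\<close> with \<open>t\<close> equal to the \<open>L\<^sup>p\<close> norm of \<open>v\<close> makes both summands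
  multiples of \<open>t\<^sup>q\<close>. The constant is not the optimal one of Hoelder's inequality, but it
  depends only on the measure of \<open>\<Omega>\<close>, as continuity of the embedding requires.
\<close>

lemma Lp_norm_le_Lp_norm:
  fixes \<Omega> :: "'a::euclidean_space set" and v :: "'a \<Rightarrow> 'b::euclidean_space"
  assumes "\<Omega> \<in> lmeasurable" "0 < q" "q \<le> p" "v \<in> Lp \<Omega> p"
  shows "Lp_norm \<Omega> q v \<le> (measure lebesgue \<Omega> + 1) powr (1 / q) * Lp_norm \<Omega> p v"
proof (cases "Lp_norm \<Omega> p v = 0")
  case True
  have "v \<in> Lp \<Omega> q"
    using assms by (intro Lp_mono_exponent[of \<Omega> q p]) auto
  with True show ?thesis
    using assms Lp_norm_eq_0_iff[of p v \<Omega>] Lp_norm_eq_0_iff[of q v \<Omega>] by simp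
next
  case False
  define t where "t = Lp_norm \<Omega> p v"
  have t: "0 < t"
    using False by (simp add: t_def Lp_norm_def)
  interpret finite_measure "lebesgue_on \<Omega>"
    using assms(1) by (rule finite_measure_lebesgue_on)
  have int: "integrable (lebesgue_on \<Omega>) (\<lambda>z. norm (v z) powr p)"
    using assms(4) by (simp add: Lp_def)
  have \<Omega>: "measure (lebesgue_on \<Omega>) (space (lebesgue_on \<Omega>)) = measure lebesgue \<Omega>"
    using assms(1) by (simp add: measure_restrict_space fmeasurableD)
  have "(LINT z|lebesgue_on \<Omega>. norm (v z) powr q)
      \<le> (LINT z|lebesgue_on \<Omega>. t powr q + t powr (q - p) * norm (v z) powr p)"
    using assms int t by (intro integral_mono_AE') (auto intro!: powr_le_split)
  also have "\<dots> = measure lebesgue \<Omega> * t powr q + t powr (q - p) * t powr p"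
    using int assms \<Omega> by (simp add: t_def Lp_norm_powr)
  also have "\<dots> = (measure lebesgue \<Omega> + 1) * t powr q"
    by (simp add: algebra_simps flip: powr_add)
  finally have "(LINT z|lebesgue_on \<Omega>. norm (v z) powr q) powr (1 / q)
      \<le> ((measure lebesgue \<Omega> + 1) * t powr q) powr (1 / q)"
    using assms by (intro powr_mono2 integral_nonneg_AE) auto
  also have "\<dots> = (measure lebesgue \<Omega> + 1) powr (1 / q) * t"
    using assms t by (simp add: powr_mult powr_powr)
  finally show ?thesis
    by (simp add: Lp_norm_def[of _ q] t_def)
qed

lemma Lp_norm_tendsto_0_mono_exponent:
  fixes \<Omega> :: "'a::euclidean_space set" and v :: "nat \<Rightarrow> 'a \<Rightarrow> 'b::euclidean_space"
  assumes "\<Omega> \<in> lmeasurable" "0 < q" "q \<le> p" "\<And>n. v n \<in> Lp \<Omega> p"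
    and "(\<lambda>n. Lp_norm \<Omega> p (v n)) \<longlonglongrightarrow> 0"
  shows "(\<lambda>n. Lp_norm \<Omega> q (v n)) \<longlonglongrightarrow> 0"
proof (rule tendsto_sandwich)
  show "\<forall>\<^sub>F n in sequentially. 0 \<le> Lp_norm \<Omega> q (v n)"
    by (simp add: Lp_norm_def)
  show "\<forall>\<^sub>F n in sequentially.
      Lp_norm \<Omega> q (v n) \<le> (measure lebesgue \<Omega> + 1) powr (1 / q) * Lp_norm \<Omega> p (v n)"
    using Lp_norm_le_Lp_norm[OF assms(1-4)] by simp
  show "(\<lambda>n. (measure lebesgue \<Omega> + 1) powr (1 / q) * Lp_norm \<Omega> p (v n)) \<longlonglongrightarrow> 0"
    using tendsto_mult_left[OF assms(5)] by simp
qed simp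

text \<open>Pointwise \<open>|v - w|\<^sup>r \<le> (2 max(|v|, |w|))\<^sup>r \<le> 2\<^sup>r (|v|\<^sup>r + |w|\<^sup>r)\<close>.\<close>

lemma Lp_diff:
  assumes "0 \<le> r" "v \<in> Lp \<Omega> r" "w \<in> Lp \<Omega> r"
  shows "(\<lambda>z. v z - w z) \<in> Lp \<Omega> r"
proof -
  have [measurable]: "v \<in> borel_measurable (lebesgue_on \<Omega>)"
      "w \<in> borel_measurable (lebesgue_on \<Omega>)"
    and int: "integrable (lebesgue_on \<Omega>) (\<lambda>z. norm (v z) powr r)"
      "integrable (lebesgue_on \<Omega>) (\<lambda>z. norm (w z) powr r)"
    using assms by (auto simp: Lp_def)
  have le: "norm (v z - w z) powr r \<le> 2 powr r * (norm (v z) powr r + norm (w z) powr r)" for z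
  proof -
    have "norm (v z - w z) \<le> 2 * max (norm (v z)) (norm (w z))"
      using norm_triangle_ineq4[of "v z" "w z"] by linarith
    then have "norm (v z - w z) powr r \<le> (2 * max (norm (v z)) (norm (w z))) powr r"
      using assms by (intro powr_mono2) auto
    also have "\<dots> = 2 powr r * max (norm (v z)) (norm (w z)) powr r"
      by (simp add: powr_mult)
    also have "\<dots> \<le> 2 powr r * (norm (v z) powr r + norm (w z) powr r)"
      by (intro mult_left_mono) (auto simp: max_def)
    finally show ?thesis .
  qed
  have "integrable (lebesgue_on \<Omega>) (\<lambda>z. norm (v z - w z) powr r)"
  proof (rule Bochner_Integration.integrable_bound)
    show "integrable (lebesgue_on \<Omega>)
        (\<lambda>z. 2 powr r * (norm (v z) powr r + norm (w z) powr r))"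
      using int by simp
    show "AE z in lebesgue_on \<Omega>. norm (norm (v z - w z) powr r)
        \<le> norm (2 powr r * (norm (v z) powr r + norm (w z) powr r))"
      using le by simp
  qed measurable
  then show ?thesis
    by (simp add: Lp_def)
qed

lemma continuous_in_Lp:
  fixes \<Omega> :: "'a::euclidean_space set" and v :: "'a \<Rightarrow> 'b::euclidean_space"
  assumes "\<Omega> \<in> lmeasurable" "bounded \<Omega>" "continuous_on UNIV v" "0 \<le> r"
  shows "v \<in> Lp \<Omega> r"
proof -
  interpret finite_measure "lebesgue_on \<Omega>"
    using assms(1) by (rule finite_measure_lebesgue_on)
  have [measurable]: "v \<in> borel_measurable (lebesgue_on \<Omega>)"
    using assms by (intro continuous_imp_measurable_on_sets_lebesgue)
      (auto intro: continuous_on_subset simp: fmeasurableD)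
  have "bounded (v ` closure \<Omega>)"
    using assms by (intro compact_imp_bounded compact_continuous_image)
      (auto intro: continuous_on_subset)
  then obtain B where B: "\<And>z. z \<in> closure \<Omega> \<Longrightarrow> norm (v z) \<le> B"
    by (auto simp: bounded_iff)
  have "integrable (lebesgue_on \<Omega>) (\<lambda>z. norm (v z) powr r)"
  proof (rule integrable_const_bound)
    show "AE z in lebesgue_on \<Omega>. norm (norm (v z) powr r) \<le> B powr r"
      using assms B closure_subset[of \<Omega>] by (intro AE_I2) (auto intro!: powr_mono2)
  qed measurable
  then show ?thesis
    by (simp add: Lp_def)
qed

section \<open>Inclusions between Sobolev spaces\<close>

lemma test_function_in_Lp:
  fixes \<Omega> :: "'a::euclidean_space set"
  assumes "\<Omega> \<in> lmeasurable" "bounded \<Omega>" "\<phi> \<in> test_functions \<Omega>" "0 \<le> r"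
  shows "\<phi> \<in> Lp \<Omega> r" "gradient \<phi> \<in> Lp \<Omega> r"
proof -
  have "Ck 0 \<phi>" "Ck (Suc 0) \<phi>"
    using assms(3) unfolding test_functions_def by blast+
  then have "continuous_on UNIV \<phi>" "continuous_on UNIV (gradient \<phi>)"
    unfolding gradient_def[abs_def] by (auto intro!: continuous_intros)
  then show "\<phi> \<in> Lp \<Omega> r" "gradient \<phi> \<in> Lp \<Omega> r"
    using assms by (auto intro: continuous_in_Lp)
qed

text \<open>
  The weak gradient of \<open>u\<close> is the same function for both exponents, and the same test
  functions approximate \<open>u\<close> in both norms.
\<close>

lemma W1p_0_subset:
  fixes \<Omega> :: "'a::euclidean_space set"
  assumes "\<Omega> \<in> lmeasurable" "bounded \<Omega>" "0 < q" "q \<le> p"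
  shows "W1p_0 \<Omega> p \<subseteq> W1p_0 \<Omega> q"
proof
  fix u assume "u \<in> W1p_0 \<Omega> p"
  then obtain \<phi> where u: "u \<in> W1p \<Omega> p" and \<phi>: "\<And>n. \<phi> n \<in> test_functions \<Omega>"
    and lim: "(\<lambda>n. Lp_norm \<Omega> p (\<lambda>z. \<phi> n z - u z)) \<longlonglongrightarrow> 0"
      "(\<lambda>n. Lp_norm \<Omega> p (\<lambda>z. gradient (\<phi> n) z - weak_gradient \<Omega> u z)) \<longlonglongrightarrow> 0"
    by (auto simp: W1p_0_def)
  have uLp: "u \<in> Lp \<Omega> p" "weak_gradient \<Omega> u \<in> Lp \<Omega> p"
    using u by (auto simp: W1p_def)
  then have "u \<in> W1p \<Omega> q"
    using u assms by (auto simp: W1p_def intro: Lp_mono_exponent[of \<Omega> q p])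
  moreover have "(\<lambda>n. Lp_norm \<Omega> q (\<lambda>z. \<phi> n z - u z)) \<longlonglongrightarrow> 0"
    using assms uLp \<phi> lim
    by (intro Lp_norm_tendsto_0_mono_exponent[of \<Omega> q p] Lp_diff)
      (auto intro: test_function_in_Lp)
  moreover have "(\<lambda>n. Lp_norm \<Omega> q (\<lambda>z. gradient (\<phi> n) z - weak_gradient \<Omega> u z)) \<longlonglongrightarrow> 0"
    using assms uLp \<phi> lim
    by (intro Lp_norm_tendsto_0_mono_exponent[of \<Omega> q p] Lp_diff)
      (auto intro: test_function_in_Lp)
  ultimately show "u \<in> W1p_0 \<Omega> q"
    using \<phi> by (auto simp: W1p_0_def)
qed

section \<open>The first eigenvalue\<close>

lemma integral_weight_nonneg:
  fixes g :: "'a::euclidean_space \<Rightarrow> 'b::real_normed_vector"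
  assumes "\<And>z. z \<in> \<Omega> \<Longrightarrow> 0 \<le> a z"
  shows "0 \<le> (LINT z|lebesgue_on \<Omega>. a z * norm (g z) powr r)"
  using assms by (intro integral_nonneg_AE AE_I2) simp

text \<open>
  A nonnegative weight bounds the Rayleigh quotients from below, so that their infimum is
  indeed a lower bound for each of them.
\<close>

lemma lambda1_Lp_norm_le:
  fixes \<Omega> :: "'a::euclidean_space set"
  assumes "0 < r" "\<And>z. z \<in> \<Omega> \<Longrightarrow> 0 \<le> a z" "u \<in> W1p_0 \<Omega> r" "nonzero_on \<Omega> u"
  shows "lambda1 \<Omega> r a * Lp_norm \<Omega> r u powr r
      \<le> (LINT z|lebesgue_on \<Omega>. a z * norm (weak_gradient \<Omega> u z) powr r)"
proof -
  have "u \<in> Lp \<Omega> r"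
    using assms(3) by (auto simp: W1p_0_def W1p_def)
  then have "Lp_norm \<Omega> r u \<noteq> 0"
    using assms by (simp add: Lp_norm_eq_0_iff nonzero_on_def)
  then have pos: "0 < Lp_norm \<Omega> r u powr r"
    by simp
  have "lambda1 \<Omega> r a \<le>
      (LINT z|lebesgue_on \<Omega>. a z * norm (weak_gradient \<Omega> u z) powr r) / Lp_norm \<Omega> r u powr r"
    unfolding lambda1_def
  proof (rule cINF_lower)
    show "bdd_below ((\<lambda>u. (LINT z|lebesgue_on \<Omega>. a z * norm (weak_gradient \<Omega> u z) powr r)
        / Lp_norm \<Omega> r u powr r) ` {u \<in> W1p_0 \<Omega> r. nonzero_on \<Omega> u})"
      using assms(2) by (intro bdd_belowI2[where m = 0] divide_nonneg_nonneg integral_weight_nonneg)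
        auto
  qed (use assms in auto)
  with pos show ?thesis
    by (simp add: pos_le_divide_eq)
qed

lemma lambda1_nonneg:
  fixes \<Omega> :: "'a::euclidean_space set"
  assumes "\<And>z. z \<in> \<Omega> \<Longrightarrow> 0 \<le> a z" "u \<in> W1p_0 \<Omega> r" "nonzero_on \<Omega> u"
  shows "0 \<le> lambda1 \<Omega> r a"
  unfolding lambda1_def
  using assms by (intro cINF_greatest divide_nonneg_nonneg integral_weight_nonneg) auto

section \<open>Nonexistence\<close>

lemma powr_diff_2_mult_inner:
  fixes v :: "'a::real_inner"
  shows "norm v powr (r - 2) * (v \<bullet> v) = norm v powr r"
proof (cases "v = 0")
  case False
  then have "v \<bullet> v = norm v powr 2"
    by (simp add: dot_square_norm powr_numeral)
  then have "norm v powr (r - 2) * (v \<bullet> v) = norm v powr (r - 2 + 2)"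
    by (simp only: powr_add)
  then show ?thesis
    by simp
qed simp

theorem theorem4p3:
  fixes \<Omega> :: "'a::euclidean_space set"
    and p q \<mu> :: real
    and a1 a2 :: "'a \<Rightarrow> real"
    and f :: "'a \<Rightarrow> real \<Rightarrow> real"
  assumes "bounded_C2_domain \<Omega>"
    and "1 < q" and "q < p"
    and "H0 \<Omega> a1 a2"
    and "H1'' \<Omega> p q a1 f"
    and "0 < \<mu>" and "\<mu> < lambda1 \<Omega> q a2"
  shows "\<not> (\<exists>u. weak_solution \<Omega> p q a1 a2 f \<mu> u \<and> nonzero_on \<Omega> u)"
proof
  assume "\<exists>u. weak_solution \<Omega> p q a1 a2 f \<mu> u \<and> nonzero_on \<Omega> u"
  then obtain u where sol: "weak_solution \<Omega> p q a1 a2 f \<mu> u" and nz: "nonzero_on \<Omega> u"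
    by blast
  have bdd: "bounded \<Omega>" and \<Omega>: "\<Omega> \<in> lmeasurable"
    using assms(1) by (auto simp: bounded_C2_domain_def lmeasurable_open)
  obtain c where c: "0 < c" "\<And>z. z \<in> closure \<Omega> \<Longrightarrow> c \<le> a1 z \<and> c \<le> a2 z"
    using assms(4) by (auto simp: H0_def)
  have a1: "0 \<le> a1 z" and a2: "0 \<le> a2 z" if "z \<in> \<Omega>" for z
    using c(1) c(2)[of z] that closure_subset[of \<Omega>] by force+
  have up: "u \<in> W1p_0 \<Omega> p"
    using sol by (simp add: weak_solution_def)
  then have uq: "u \<in> W1p_0 \<Omega> q"
    using W1p_0_subset[of \<Omega> q p] \<Omega> bdd assms(2,3) by auto
  have Lp: "u \<in> Lp \<Omega> p" "u \<in> Lp \<Omega> q"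
    using up uq by (auto simp: W1p_0_def W1p_def)
  have int: "integrable (lebesgue_on \<Omega>) (\<lambda>z. \<bar>u z\<bar> powr p)"
      "integrable (lebesgue_on \<Omega>) (\<lambda>z. \<bar>u z\<bar> powr q)"
    using Lp by (auto simp: Lp_def)
  let ?G = "\<lambda>a r. LINT z|lebesgue_on \<Omega>. a z * norm (weak_gradient \<Omega> u z) powr r"
  have "?G a1 p + ?G a2 q =
      (LINT z|lebesgue_on \<Omega>. (\<mu> * \<bar>u z\<bar> powr (q - 2) * u z + f z (u z)) * u z)"
    using sol up by (auto simp: weak_solution_def mult.assoc powr_diff_2_mult_inner)
  \<comment> \<open>The reaction term is bounded by a nonnegative integrable function, so the inequality
     between the integrals holds even if the term itself fails to be integrable, the integral
     then being \<open>0\<close>.\<close>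
  also have "\<dots> \<le> (LINT z|lebesgue_on \<Omega>.
      \<mu> * \<bar>u z\<bar> powr q + lambda1 \<Omega> p a1 * \<bar>u z\<bar> powr p)"
  proof (rule integral_mono_AE')
    have "AE z in lebesgue_on \<Omega>. f z (u z) * u z \<le> lambda1 \<Omega> p a1 * \<bar>u z\<bar> powr p"
      using assms(5) unfolding H1''_def by (auto elim: AE_mp)
    then show "AE z in lebesgue_on \<Omega>. (\<mu> * \<bar>u z\<bar> powr (q - 2) * u z + f z (u z)) * u z
        \<le> \<mu> * \<bar>u z\<bar> powr q + lambda1 \<Omega> p a1 * \<bar>u z\<bar> powr p"
    proof eventually_elim
      case (elim z)
      then show ?case
        using powr_diff_2_mult_inner[of "u z" q] by (simp add: distrib_right mult.assoc)
    qed
    show "AE z in lebesgue_on \<Omega>. 0 \<le> \<mu> * \<bar>u z\<bar> powr q + lambda1 \<Omega> p a1 * \<bar>u z\<bar> powr p"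
      using lambda1_nonneg[OF a1 up nz] assms(6) by simp
  qed (use int in simp)
  also have "\<dots> = \<mu> * Lp_norm \<Omega> q u powr q + lambda1 \<Omega> p a1 * Lp_norm \<Omega> p u powr p"
    using int assms(2,3) by (simp add: Lp_norm_powr)
  also have "\<dots> \<le> \<mu> * Lp_norm \<Omega> q u powr q + ?G a1 p"
    using lambda1_Lp_norm_le[OF _ a1 up nz] assms(2,3) by simp
  finally have "?G a2 q \<le> \<mu> * Lp_norm \<Omega> q u powr q"
    by simp
  moreover have "\<mu> * Lp_norm \<Omega> q u powr q < lambda1 \<Omega> q a2 * Lp_norm \<Omega> q u powr q"
    using assms(2,7) Lp(2) nz by (simp add: Lp_norm_eq_0_iff nonzero_on_def)
  moreover have "lambda1 \<Omega> q a2 * Lp_norm \<Omega> q u powr q \<le> ?G a2 q"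
    using lambda1_Lp_norm_le[OF _ a2 uq nz] assms(2) by simp
  ultimately show False
    by simp
qed

end
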